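(* Let $P\subset\mathbb{R}^d$ be a $d$-dimensional convex polytope containing the origin in its interior, and let $U$ be an orthogonal transformation of $\mathbb{R}^d$ with $P=UP^\circ$. Then $U^2P=P$, and $U$ is periodic (i.e. $U^n=I$ for some positive integer $n$) and its period (the least such $n$) is even.
   Context: For $A\subseteq\mathbb{R}^d$, the polar is $A^\circ=\{x\in\mathbb{R}^d:\langle x,a\rangle\le 1\text{ for all }a\in A\}$. An orthogonal transformation is a linear map $U$ with $U^T=U^{-1}$.
   Formalization: The evenness of the period is claimed only for d ≥ 2, since it fails for d = 1 (P = [-1,1], U = I has period 1) and for d = 0; U²P = P and the periodicity of U are proved for every d ≥ 1. *)

theory Defs
  imports "HOL-Analysis.Analysis"
begin

definition polar :: "'a::real_inner set \<Rightarrow> 'a set" where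
  "polar A = {x. \<forall>a\<in>A. x \<bullet> a \<le> 1}"

definition periodic_map :: "('a \<Rightarrow> 'a) \<Rightarrow> bool" where
  "periodic_map f \<longleftrightarrow> (\<exists>n>0. f ^^ n = id)"

(* Only meaningful for maps satisfying periodic_map.
   For a polytope P = U P^o in R^d the period of U is claimed to be even only if d >= 2:
   in R^1, P = [-1,1] and U = id satisfy P = U P^o, and id has period 1. *)
definition map_period :: "('a \<Rightarrow> 'a) \<Rightarrow> nat" where
  "map_period f = (LEAST n. n > 0 \<and> f ^^ n = id)"

(* The library's orthogonal_transformation (linear and inner product preserving)
   agrees with the definition by "transpose = inverse". *)
lemma orthogonal_transformation_iff_adjoint_inverse:
  fixes U :: "real ^ 'd \<Rightarrow> real ^ 'd"
  shows "orthogonal_transformation U \<longleftrightarrow>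
           linear U \<and> adjoint U \<circ> U = id \<and> U \<circ> adjoint U = id"
proof
  assume U: "orthogonal_transformation U"
  then have lin: "linear U" and ip: "\<And>v w. U v \<bullet> U w = v \<bullet> w"
    by (auto simp: orthogonal_transformation_def)
  have left: "adjoint U (U x) = x" for x
    by (metis adjoint_works[OF lin] ip vector_eq_ldot)
  have "surj U"
    using U orthogonal_transformation_surj by blast
  then have "U (adjoint U y) = y" for y
    by (metis left surj_def)
  with lin left show "linear U \<and> adjoint U \<circ> U = id \<and> U \<circ> adjoint U = id"
    by (simp add: fun_eq_iff)
next
  assume "linear U \<and> adjoint U \<circ> U = id \<and> U \<circ> adjoint U = id"
  then have lin: "linear U" and left: "\<And>x. adjoint U (U x) = x"
    by (auto simp: fun_eq_iff)
  show "orthogonal_transformation U"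
    unfolding orthogonal_transformation_def
    by (metis adjoint_works[OF lin] left lin)
qed

end

theory Submission
  imports Defs
begin

text \<open>
  Since \<open>U\<close> commutes with taking polars and \<open>P\<close> is its own bipolar, \<open>polar P = U P\<close> and hence
  \<open>P = U\<^sup>2 P\<close>. So \<open>U\<^sup>2\<close> permutes the vertices of \<open>P\<close>, a finite spanning set, and has finite order.
  If \<open>U\<close> had odd order it would be a power of \<open>U\<^sup>2\<close>, so \<open>P = U P = polar P\<close>; but the only set equal
  to its polar is the unit ball, which in dimension at least 2 has infinitely many extreme points.
\<close>

lemma polar_orthogonal_image:
  fixes U :: "'a::euclidean_space \<Rightarrow> 'a"
  assumes "orthogonal_transformation U"
  shows "polar (U ` A) = U ` polar A"
proof (intro set_eqI iffI)
  fix x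
  assume x: "x \<in> polar (U ` A)"
  obtain y where "x = U y"
    using orthogonal_transformation_surj[OF assms] by (metis surjD)
  with x show "x \<in> U ` polar A"
    using assms by (auto simp: polar_def orthogonal_transformation_def)
qed (use assms in \<open>auto simp: polar_def orthogonal_transformation_def\<close>)

text \<open>A point \<open>z\<close> outside \<open>S\<close> is strictly separated from
  \<open>S\<close> by a hyperplane. As \<open>0\<close> lies in \<open>S\<close>, the offset is
  nonzero, so the normal can be rescaled to a member of \<open>polar S\<close> whose product with
  \<open>z\<close> exceeds 1.\<close>

lemma bipolar:
  fixes S :: "'a::euclidean_space set"
  assumes "convex S" "closed S" "0 \<in> S"
  shows "polar (polar S) = S"
proof
  show "S \<subseteq> polar (polar S)"
    by (auto simp: polar_def inner_commute)
next
  show "polar (polar S) \<subseteq> S"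
  proof (rule ccontr)
    assume "\<not> polar (polar S) \<subseteq> S"
    then obtain z where z: "z \<in> polar (polar S)" "z \<notin> S"
      by blast
    obtain a b where ab: "a \<bullet> z < b" "\<forall>x\<in>S. a \<bullet> x > b"
      using separating_hyperplane_closed_point[OF assms(1,2) z(2)] by blast
    have "b < 0"
      using ab(2) assms(3) by force
    \<comment> \<open>Dividing by the negative \<open>b\<close> reverses both inequalities: the
      product is below 1 on \<open>S\<close> and above 1 at \<open>z\<close>.\<close>
    have "a /\<^sub>R b \<in> polar S"
      using ab(2) \<open>b < 0\<close> by (force simp: polar_def divide_simps)
    moreover have "\<forall>y\<in>polar S. z \<bullet> y \<le> 1"
      using z(1) by (simp add: polar_def[of "polar S"])
    ultimately have "z \<bullet> (a /\<^sub>R b) \<le> 1"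
      by blast
    then show False
      using ab(1) \<open>b < 0\<close> by (simp add: inner_commute divide_simps split: if_splits)
  qed
qed

text \<open>Pairing a point of \<open>S\<close> with itself bounds its norm by 1; then
  Cauchy-Schwarz puts the whole ball into the polar of \<open>S\<close>.\<close>

lemma self_polar_eq_cball:
  fixes S :: "'a::real_inner set"
  assumes "polar S = S"
  shows "S = cball 0 1"
proof
  show sub: "S \<subseteq> cball 0 1"
  proof
    fix x assume "x \<in> S"
    then have "x \<bullet> x \<le> 1"
      using assms by (auto simp: polar_def)
    then show "x \<in> cball 0 1"
      by (simp add: norm_le_square)
  qed
  show "cball 0 1 \<subseteq> S"
  proof
    fix x :: 'a assume x: "x \<in> cball 0 1"
    have "x \<bullet> a \<le> 1" if "a \<in> S" for a
    proof -
      have "x \<bullet> a \<le> norm x * norm a"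
        by (rule norm_cauchy_schwarz)
      also have "\<dots> \<le> 1"
        using x sub that by (intro mult_le_one) auto
      finally show ?thesis .
    qed
    then show "x \<in> S"
      using assms by (auto simp: polar_def)
  qed
qed

text \<open>The tangent hyperplane at \<open>x\<close> supports the ball and meets it only in
  \<open>x\<close>, so \<open>{x}\<close> is a face.\<close>

lemma sphere_extreme_point_of_cball:
  fixes x :: "'a::real_inner"
  assumes "norm x = 1"
  shows "x extreme_point_of cball 0 1"
proof -
  have xx: "x \<bullet> x = 1"
    using assms by (simp add: norm_eq_1)
  have le: "x \<bullet> y \<le> 1" if "y \<in> cball 0 1" for y
    using norm_cauchy_schwarz[of x y] that assms by simp
  have "y = x" if "y \<in> cball 0 1" "x \<bullet> y = 1" for y
  proof -
    have "y \<bullet> y \<le> 1"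
      using that(1) by (simp add: norm_le_square)
    \<comment> \<open>The square expands to \<open>y \<bullet> y - 2 + 1\<close>, which is at most
      0.\<close>
    then have "\<not> (y - x) \<bullet> (y - x) > 0"
      using that(2) xx by (simp add: inner_diff inner_commute)
    then show ?thesis
      unfolding inner_gt_zero_iff by simp
  qed
  then have "cball 0 1 \<inter> {y. x \<bullet> y = 1} = {x}"
    using xx assms by auto
  then show ?thesis
    using face_of_Int_supporting_hyperplane_le[OF convex_cball, of 0 1 x 1] le
    by (simp add: face_of_singleton)
qed

text \<open>From dimension 2 on the sphere is connected; were it finite, it would be a single point,
  yet it contains antipodes.\<close>

lemma not_polytope_cball:
  assumes "DIM('a::euclidean_space) \<ge> 2"
  shows "\<not> polytope (cball (0::'a) 1)"
proof
  assume "polytope (cball (0::'a) 1)"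
  then have "finite {v. v extreme_point_of cball (0::'a) 1}"
    by (intro finite_polyhedron_extreme_points polytope_imp_polyhedron)
  then have "finite (sphere (0::'a) 1)"
    by (rule rev_finite_subset) (auto intro: sphere_extreme_point_of_cball)
  then obtain a :: 'a where a: "sphere (0::'a) 1 \<subseteq> {a}"
    using connected_finite_iff_sing[of "sphere (0::'a) 1"] assms
    by (auto simp: connected_sphere_eq)
  obtain b :: 'a where "b \<in> Basis"
    using nonempty_Basis by blast
  then have "b \<in> sphere 0 1" "- b \<in> sphere 0 1"
    by simp_all
  then have "- b = b"
    using a by blast
  then have "- (b \<bullet> b) = b \<bullet> b"
    by (metis inner_minus_left)
  then show False
    using \<open>b \<in> Basis\<close> by simp
qed

text \<open>By pigeonhole two powers of \<open>f\<close> agree on \<open>V\<close>, hence everywhere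
  by linearity, and injectivity cancels the smaller power.\<close>

lemma finite_order_if_permutes_finite_spanning:
  fixes f :: "'a::euclidean_space \<Rightarrow> 'a"
  assumes "linear f" "inj f" "finite V" "f ` V \<subseteq> V" "span V = UNIV"
  obtains m where "m > 0" "f ^^ m = id"
proof -
  have stable: "(f ^^ n) v \<in> V" if "v \<in> V" for n v
    using that assms(4) by (induction n) auto
  have lin: "linear (f ^^ n)" for n
  proof (induction n)
    case (Suc n)
    show ?case
      using linear_compose[OF Suc assms(1)] by (simp add: o_def)
  qed (simp add: linear_iff)
  \<comment> \<open>Restriction fixes the values off \<open>V\<close> to \<open>undefined\<close>,
    which makes the space of self-maps of \<open>V\<close> finite.\<close>
  have "range (\<lambda>n. restrict (f ^^ n) V) \<subseteq> V \<rightarrow>\<^sub>E V"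
    using stable by auto
  then have "finite (range (\<lambda>n. restrict (f ^^ n) V))"
    by (rule finite_subset) (intro finite_PiE assms(3))
  then have "\<not> inj (\<lambda>n. restrict (f ^^ n) V)"
    using finite_imageD infinite_UNIV_nat by blast
  then obtain i j where ij: "i < j" "restrict (f ^^ i) V = restrict (f ^^ j) V"
    unfolding inj_def by (metis linorder_neqE_nat)
  have "(f ^^ i) v = (f ^^ j) v" if "v \<in> V" for v
    using ij(2) that by (metis restrict_apply')
  then have eq: "(f ^^ i) x = (f ^^ j) x" for x
    using linear_eq_on_span[OF lin lin, of V i j x] assms(5) by auto
  have "(f ^^ (j - i)) x = x" for x
  proof -
    have "(f ^^ i) ((f ^^ (j - i)) x) = (f ^^ i) x"
      using eq[of x] ij(1) by (metis comp_apply funpow_add le_add_diff_inverse less_imp_le)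
    then show ?thesis
      using inj_fn[OF assms(2)] by (metis injD)
  qed
  then show thesis
    using that[of "j - i"] ij(1) by (simp add: fun_eq_iff)
qed

lemma extreme_points_linear_image_subset:
  fixes f :: "'a::real_vector \<Rightarrow> 'b::real_vector"
  assumes "linear f" "inj f"
  shows "f ` {v. v extreme_point_of S} \<subseteq> {v. v extreme_point_of (f ` S)}"
proof -
  have "{f v} face_of f ` S" if "{v} face_of S" for v
    using face_of_linear_image[OF assms, of "{v}" S] that by simp
  then show ?thesis
    by (auto simp: face_of_singleton)
qed

text \<open>By Krein-Milman the span contains \<open>S\<close>, and a proper subspace has empty
  interior.\<close>

lemma span_extreme_points:
  fixes S :: "'a::euclidean_space set"
  assumes "compact S" "convex S" "interior S \<noteq> {}"
  shows "span {v. v extreme_point_of S} = UNIV"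
proof -
  let ?V = "{v. v extreme_point_of S}"
  have "S \<subseteq> span ?V"
    using Krein_Milman_Minkowski[OF assms(1,2)] convex_hull_subset_span by metis
  then have "interior (span ?V) \<noteq> {}"
    using assms(3) interior_mono by blast
  then have "\<not> dim (span ?V) < DIM('a)"
    using empty_interior_lowdim by blast
  then show ?thesis
    by (metis dim_eq_full dim_span dim_subset_UNIV le_neq_implies_less)
qed

theorem theorem3p3:
  fixes P :: "(real ^ 'd) set"
    and U :: "real ^ 'd \<Rightarrow> real ^ 'd"
  assumes "polytope P"
    and "aff_dim P = int CARD('d)"
    and "0 \<in> interior P"
    and "orthogonal_transformation U"
    and "P = U ` polar P"
  shows "(U ^^ 2) ` P = P
    \<and> periodic_map U
    \<and> (CARD('d) \<ge> 2 \<longrightarrow> even (map_period U))"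
proof -
  have P: "compact P" "convex P" "closed P" "0 \<in> P"
    using assms(1,3) interior_subset
    by (auto simp: polytope_imp_compact polytope_imp_convex polytope_imp_closed)
  have polar: "polar P = U ` P"
    using polar_orthogonal_image[OF assms(4), of "polar P"] bipolar[OF P(2-4)] assms(5) by metis
  have U2: "(U ^^ 2) ` P = P"
    using polar assms(5) by (simp add: numeral_2_eq_2 image_comp)
  have linU: "linear U" and injU: "inj U"
    using assms(4) orthogonal_transformation_linear orthogonal_transformation_inj by auto
  have lin2: "linear (U ^^ 2)"
    using linear_compose[OF linU linU] by (simp add: numeral_2_eq_2)
  have inj2: "inj (U ^^ 2)"
    using injU by (rule inj_fn)
  let ?V = "{v. v extreme_point_of P}"
  have "finite ?V"
    using assms(1) by (intro finite_polyhedron_extreme_points polytope_imp_polyhedron)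
  moreover have "(U ^^ 2) ` ?V \<subseteq> ?V"
    using extreme_points_linear_image_subset[OF lin2 inj2, of P] U2 by simp
  moreover have "span ?V = UNIV"
    using span_extreme_points[OF P(1,2)] assms(3) by blast
  ultimately obtain m where "m > 0" "(U ^^ 2) ^^ m = id"
    using finite_order_if_permutes_finite_spanning[OF lin2 inj2] by blast
  then have periodic: "\<exists>n>0. U ^^ n = id"
    by (intro exI[of _ "2 * m"]) (simp add: funpow_mult mult.commute)
  have "even (map_period U)" if d: "CARD('d) \<ge> 2"
  proof (rule ccontr)
    assume "odd (map_period U)"
    then obtain k where k: "map_period U = Suc (2 * k)"
      by (auto elim: oddE)
    have "U ^^ map_period U = id"
      unfolding map_period_def using LeastI_ex[OF periodic] by blast
    \<comment> \<open>Thus \<open>U\<close> is inverse to a power of \<open>U ^^ 2\<close>, and that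
      power maps \<open>P\<close> onto itself; so does \<open>U\<close>.\<close>
    then have id: "U \<circ> (U ^^ 2) ^^ k = id"
      using k by (simp add: funpow_mult mult.commute)
    have "((U ^^ 2) ^^ k) ` P = P"
      by (induction k) (simp, simp only: funpow.simps image_comp[symmetric] U2)
    then have "U ` P = (U \<circ> (U ^^ 2) ^^ k) ` P"
      by (simp only: image_comp[symmetric])
    then have "U ` P = P"
      unfolding id by simp
    then have "P = cball 0 1"
      using polar self_polar_eq_cball by metis
    then show False
      using assms(1) d not_polytope_cball[where 'a = "real ^ 'd"] by simp
  qed
  then show ?thesis
    using U2 periodic unfolding periodic_map_def by blast
qed

end
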